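(* Every satisfiable $\mathrm{UNFP}$ formula of width $k$ has a model of tree-width at most $k-1$.
   Context: $\mathrm{UNFO}$ consists of the first-order formulas generated by $\phi ::= R(\bar x)\mid x=y\mid \phi\wedge\phi\mid\phi\vee\phi\mid\exists x\,\phi\mid\neg\phi$, where in the last clause $\phi$ has at most one free first-order variable. $\mathrm{UNFP}$ extends it with unary second-order variables $X$ used as atoms $X(x)$ (negation still only applied to formulas with at most one free first-order variable) and least fixpoint formulas $[\mathrm{LFP}_{X,x}\,\phi(X,\bar X,x)](y)$ where $X$ occurs only positively in $\phi$ and $\phi$ has no free first-order variable other than $x$ (usual least-fixpoint semantics). A formula is in UN-normal form if every existential quantifier in its syntax tree, except at the root, either is directly below another existential quantifier or starts a subformula with at most one free first-order variable. Formulas are put into UN-normal form using the rewrite rules $\phi\wedge\exists x\psi\equiv\exists x(\phi\wedge\psi)$ and $\phi\vee\exists x\psi\equiv\exists x(\phi\vee\psi)$ ($x$ not free in $\phi$), with renaming of bound variables. A $\mathrm{UNFP}$ formula has width $k$ if it can be put in UN-normal form in this way so that the result uses at most $k$ first-order variables. *)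

theory Defs
  imports Main
begin

text \<open>First-order and unary second-order variables are both named by natural numbers,
  in separate name spaces.  The formula \<open>[LFP\<^sub>X\<^sub>,\<^sub>x \<phi>](y)\<close> is written \<open>Lfp X x \<phi> y\<close>.\<close>

datatype 'r fm =
    Rel 'r "nat list"
  | Eq nat nat
  | SVar nat nat
  | And "'r fm" "'r fm"
  | Or "'r fm" "'r fm"
  | Ex nat "'r fm"
  | Neg "'r fm"
  | Lfp nat nat "'r fm" nat

primrec fv :: "'r fm \<Rightarrow> nat set" where
  "fv (Rel R xs) = set xs"
| "fv (Eq x y) = {x, y}"
| "fv (SVar X x) = {x}"
| "fv (And \<phi> \<psi>) = fv \<phi> \<union> fv \<psi>"
| "fv (Or \<phi> \<psi>) = fv \<phi> \<union> fv \<psi>"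
| "fv (Ex x \<phi>) = fv \<phi> - {x}"
| "fv (Neg \<phi>) = fv \<phi>"
| "fv (Lfp X x \<phi> y) = insert y (fv \<phi> - {x})"

text \<open>All first-order variables used, free or bound; a quantified variable counts even if
  its scope does not mention it.\<close>

primrec vars :: "'r fm \<Rightarrow> nat set" where
  "vars (Rel R xs) = set xs"
| "vars (Eq x y) = {x, y}"
| "vars (SVar X x) = {x}"
| "vars (And \<phi> \<psi>) = vars \<phi> \<union> vars \<psi>"
| "vars (Or \<phi> \<psi>) = vars \<phi> \<union> vars \<psi>"
| "vars (Ex x \<phi>) = insert x (vars \<phi>)"
| "vars (Neg \<phi>) = vars \<phi>"
| "vars (Lfp X x \<phi> y) = {x, y} \<union> vars \<phi>"

text \<open>\<open>polarity X True \<phi>\<close>: every free occurrence of \<open>X\<close> is under an even number of negations;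
  \<open>polarity X False \<phi>\<close>: under an odd number.\<close>

primrec polarity :: "nat \<Rightarrow> bool \<Rightarrow> 'r fm \<Rightarrow> bool" where
  "polarity X b (Rel R xs) = True"
| "polarity X b (Eq x y) = True"
| "polarity X b (SVar Y x) = (Y = X \<longrightarrow> b)"
| "polarity X b (And \<phi> \<psi>) = (polarity X b \<phi> \<and> polarity X b \<psi>)"
| "polarity X b (Or \<phi> \<psi>) = (polarity X b \<phi> \<and> polarity X b \<psi>)"
| "polarity X b (Ex x \<phi>) = polarity X b \<phi>"
| "polarity X b (Neg \<phi>) = polarity X (\<not> b) \<phi>"
| "polarity X b (Lfp Y x \<phi> y) = (Y = X \<or> polarity X b \<phi>)"

text \<open>\<open>ar\<close> assigns an arity to each relation symbol of the signature.\<close>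

primrec unfp :: "('r \<Rightarrow> nat) \<Rightarrow> 'r fm \<Rightarrow> bool" where
  "unfp ar (Rel R xs) = (length xs = ar R)"
| "unfp ar (Eq x y) = True"
| "unfp ar (SVar X x) = True"
| "unfp ar (And \<phi> \<psi>) = (unfp ar \<phi> \<and> unfp ar \<psi>)"
| "unfp ar (Or \<phi> \<psi>) = (unfp ar \<phi> \<and> unfp ar \<psi>)"
| "unfp ar (Ex x \<phi>) = unfp ar \<phi>"
| "unfp ar (Neg \<phi>) = (unfp ar \<phi> \<and> card (fv \<phi>) \<le> 1)"
| "unfp ar (Lfp X x \<phi> y) = (unfp ar \<phi> \<and> polarity X True \<phi> \<and> fv \<phi> \<subseteq> {x})"

record ('r, 'a) relstruct =
  univ :: "'a set"
  interp :: "'r \<Rightarrow> 'a list set"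

definition is_structure :: "('r \<Rightarrow> nat) \<Rightarrow> ('r, 'a) relstruct \<Rightarrow> bool" where
  "is_structure ar M \<longleftrightarrow> univ M \<noteq> {} \<and>
     (\<forall>R. \<forall>t \<in> interp M R. length t = ar R \<and> set t \<subseteq> univ M)"

primrec sat :: "('r, 'a) relstruct \<Rightarrow> (nat \<Rightarrow> 'a set) \<Rightarrow> (nat \<Rightarrow> 'a) \<Rightarrow> 'r fm \<Rightarrow> bool" where
  "sat M S e (Rel R xs) = (map e xs \<in> interp M R)"
| "sat M S e (Eq x y) = (e x = e y)"
| "sat M S e (SVar X x) = (e x \<in> S X)"
| "sat M S e (And \<phi> \<psi>) = (sat M S e \<phi> \<and> sat M S e \<psi>)"
| "sat M S e (Or \<phi> \<psi>) = (sat M S e \<phi> \<or> sat M S e \<psi>)"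
| "sat M S e (Ex x \<phi>) = (\<exists>a \<in> univ M. sat M S (e(x := a)) \<phi>)"
| "sat M S e (Neg \<phi>) = (\<not> sat M S e \<phi>)"
| "sat M S e (Lfp X x \<phi> y) =
     (e y \<in> lfp (\<lambda>A. {a \<in> univ M. sat M (S(X := A)) (e(x := a)) \<phi>}))"

text \<open>Formulas may have free variables of both sorts, so a model consists of a structure
  together with a valuation of the second-order and of the first-order variables.\<close>

definition is_model ::
  "('r \<Rightarrow> nat) \<Rightarrow> ('r, 'a) relstruct \<Rightarrow> (nat \<Rightarrow> 'a set) \<Rightarrow> (nat \<Rightarrow> 'a) \<Rightarrow> 'r fm \<Rightarrow> bool" where
  "is_model ar M S e \<phi> \<longleftrightarrow> is_structure ar M \<and> (\<forall>X. S X \<subseteq> univ M) \<and> (\<forall>x. e x \<in> univ M) \<and>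
     sat M S e \<phi>"

definition satisfiable :: "'a itself \<Rightarrow> ('r \<Rightarrow> nat) \<Rightarrow> 'r fm \<Rightarrow> bool" where
  "satisfiable _ ar \<phi> \<longleftrightarrow> (\<exists>(M :: ('r, 'a) relstruct) S e. is_model ar M S e \<phi>)"

text \<open>The flag says that an existential quantifier at this position is exempt from the
  restriction on free variables, being at the root or directly below another one.\<close>

primrec un_nf_at :: "bool \<Rightarrow> 'r fm \<Rightarrow> bool" where
  "un_nf_at b (Rel R xs) = True"
| "un_nf_at b (Eq x y) = True"
| "un_nf_at b (SVar X x) = True"
| "un_nf_at b (And \<phi> \<psi>) = (un_nf_at False \<phi> \<and> un_nf_at False \<psi>)"
| "un_nf_at b (Or \<phi> \<psi>) = (un_nf_at False \<phi> \<and> un_nf_at False \<psi>)"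
| "un_nf_at b (Ex x \<phi>) = ((b \<or> card (fv (Ex x \<phi>)) \<le> 1) \<and> un_nf_at True \<phi>)"
| "un_nf_at b (Neg \<phi>) = un_nf_at False \<phi>"
| "un_nf_at b (Lfp X x \<phi> y) = un_nf_at False \<phi>"

definition un_normal_form :: "'r fm \<Rightarrow> bool" where
  "un_normal_form \<phi> \<longleftrightarrow> un_nf_at True \<phi>"

text \<open>\<open>subst x y \<phi>\<close> replaces the free occurrences of \<open>x\<close> by \<open>y\<close>; it is only used for
  \<open>y \<notin> vars \<phi>\<close>, where no capture can occur.\<close>

primrec subst :: "nat \<Rightarrow> nat \<Rightarrow> 'r fm \<Rightarrow> 'r fm" where
  "subst x y (Rel R xs) = Rel R (map (id(x := y)) xs)"
| "subst x y (Eq u v) = Eq ((id(x := y)) u) ((id(x := y)) v)"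
| "subst x y (SVar X u) = SVar X ((id(x := y)) u)"
| "subst x y (And \<phi> \<psi>) = And (subst x y \<phi>) (subst x y \<psi>)"
| "subst x y (Or \<phi> \<psi>) = Or (subst x y \<phi>) (subst x y \<psi>)"
| "subst x y (Ex z \<phi>) = Ex z (if z = x then \<phi> else subst x y \<phi>)"
| "subst x y (Neg \<phi>) = Neg (subst x y \<phi>)"
| "subst x y (Lfp X z \<phi> u) = Lfp X z (if z = x then \<phi> else subst x y \<phi>) ((id(x := y)) u)"

text \<open>The rewrite rules, oriented so as to pull quantifiers outwards, and their mirror images
  for commuted conjuncts and disjuncts.  The two renaming rules require a variable that does
  not occur in the scope at all; passing through fresh names, their iteration still yields
  every renaming of bound first-order variables.\<close>

inductive un_step :: "'r fm \<Rightarrow> 'r fm \<Rightarrow> bool" where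
  pull_and_right: "x \<notin> fv \<phi> \<Longrightarrow> un_step (And \<phi> (Ex x \<psi>)) (Ex x (And \<phi> \<psi>))"
| pull_and_left: "x \<notin> fv \<phi> \<Longrightarrow> un_step (And (Ex x \<psi>) \<phi>) (Ex x (And \<psi> \<phi>))"
| pull_or_right: "x \<notin> fv \<phi> \<Longrightarrow> un_step (Or \<phi> (Ex x \<psi>)) (Ex x (Or \<phi> \<psi>))"
| pull_or_left: "x \<notin> fv \<phi> \<Longrightarrow> un_step (Or (Ex x \<psi>) \<phi>) (Ex x (Or \<psi> \<phi>))"
| rename_ex: "y \<notin> vars \<phi> \<Longrightarrow> un_step (Ex x \<phi>) (Ex y (subst x y \<phi>))"
| rename_lfp: "y \<notin> vars \<phi> \<Longrightarrow> un_step (Lfp X x \<phi> z) (Lfp X y (subst x y \<phi>) z)"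
| and_left: "un_step \<phi> \<phi>' \<Longrightarrow> un_step (And \<phi> \<psi>) (And \<phi>' \<psi>)"
| and_right: "un_step \<psi> \<psi>' \<Longrightarrow> un_step (And \<phi> \<psi>) (And \<phi> \<psi>')"
| or_left: "un_step \<phi> \<phi>' \<Longrightarrow> un_step (Or \<phi> \<psi>) (Or \<phi>' \<psi>)"
| or_right: "un_step \<psi> \<psi>' \<Longrightarrow> un_step (Or \<phi> \<psi>) (Or \<phi> \<psi>')"
| ex: "un_step \<phi> \<phi>' \<Longrightarrow> un_step (Ex x \<phi>) (Ex x \<phi>')"
| neg: "un_step \<phi> \<phi>' \<Longrightarrow> un_step (Neg \<phi>) (Neg \<phi>')"
| lfp: "un_step \<phi> \<phi>' \<Longrightarrow> un_step (Lfp X x \<phi> y) (Lfp X x \<phi>' y)"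

definition has_width :: "nat \<Rightarrow> 'r fm \<Rightarrow> bool" where
  "has_width k \<phi> \<longleftrightarrow> (\<exists>\<psi>. un_step\<^sup>*\<^sup>* \<phi> \<psi> \<and> un_normal_form \<psi> \<and> card (vars \<psi>) \<le> k)"

definition simple_path :: "'t set \<Rightarrow> ('t \<times> 't) set \<Rightarrow> 't \<Rightarrow> 't list \<Rightarrow> 't \<Rightarrow> bool" where
  "simple_path V E u p v \<longleftrightarrow> p \<noteq> [] \<and> hd p = u \<and> last p = v \<and> set p \<subseteq> V \<and> distinct p \<and>
     successively (\<lambda>s t. (s, t) \<in> E) p"

text \<open>Undirected, possibly infinite trees; \<open>E\<close> is a symmetric edge relation.\<close>

definition is_tree :: "'t set \<Rightarrow> ('t \<times> 't) set \<Rightarrow> bool" where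
  "is_tree V E \<longleftrightarrow> V \<noteq> {} \<and> E \<subseteq> V \<times> V \<and> sym E \<and> irrefl E \<and>
     (\<forall>u \<in> V. \<forall>v \<in> V. \<exists>!p. simple_path V E u p v)"

definition tree_decomposition ::
  "('r, 'a) relstruct \<Rightarrow> 't set \<Rightarrow> ('t \<times> 't) set \<Rightarrow> ('t \<Rightarrow> 'a set) \<Rightarrow> bool" where
  "tree_decomposition M V E B \<longleftrightarrow>
     is_tree V E \<and>
     (\<Union>t \<in> V. B t) = univ M \<and>
     (\<forall>R. \<forall>t \<in> interp M R. \<exists>v \<in> V. set t \<subseteq> B v) \<and>
     (\<forall>a \<in> univ M. let W = {v \<in> V. a \<in> B v} in
        \<forall>u \<in> W. \<forall>v \<in> W. (u, v) \<in> (E \<inter> W \<times> W)\<^sup>*)"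

text \<open>The type of tree nodes has to be fixed here.  Lists over \<open>'a\<close> are no restriction: from an
  arbitrary tree decomposition one may keep only the subtree spanned by one chosen node for each
  element and for each finite set of elements contained in some bag, and this subtree has at most
  as many nodes as there are lists over \<open>'a\<close>.\<close>

definition tree_width_at_most :: "('r, 'a) relstruct \<Rightarrow> nat \<Rightarrow> bool" where
  "tree_width_at_most M w \<longleftrightarrow>
     (\<exists>(V :: 'a list set) E B. tree_decomposition M V E B \<and>
        (\<forall>v \<in> V. finite (B v) \<and> card (B v) \<le> w + 1))"

end

theory Submission
  imports Defs "HOL-Library.Sublist"
begin

text \<open>The model is a pebble unraveling of the given one.  With \<open>m\<close> pebbles, an element is a nonempty
  sequence of moves \<open>(a, i)\<close>, ``put pebble \<open>i\<close> on \<open>a\<close>'', and stands for a fresh copy of the element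
  pebbled last.  The bag of a sequence consists of its prefixes whose last pebble has not been moved
  since, and a tuple is in a relation if it lies inside a bag and its projection is in the relation.
  The projection is a homomorphism, and the at most \<open>m\<close> values of the variables can be copied
  into a bag while keeping one prescribed element.  As quantifier blocks below the root, negations
  and fixpoints all have at most one free variable, this suffices for unary formulas to be
  invariant under the projection.\<close>

section \<open>Syntax and semantics of formulas\<close>

lemma finite_fv [simp]: "finite (fv \<phi>)"
  by (induction \<phi>) auto

lemma finite_vars [simp]: "finite (vars \<phi>)"
  by (induction \<phi>) auto

lemma fv_subset_vars: "fv \<phi> \<subseteq> vars \<phi>"
  by (induction \<phi>) auto

lemma sat_cong: "(\<And>x. x \<in> fv \<phi> \<Longrightarrow> e x = e' x) \<Longrightarrow> sat M S e \<phi> = sat M S e' \<phi>"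
proof (induction \<phi> arbitrary: S e e')
  case (Rel R xs)
  then have "map e xs = map e' xs" by simp
  then show ?case by (metis sat.simps(1))
next
  case (And \<phi> \<psi>)
  then have "sat M S e \<phi> = sat M S e' \<phi>" "sat M S e \<psi> = sat M S e' \<psi>" by (metis UnI1 UnI2 fv.simps(4))+
  then show ?case by simp
next
  case (Or \<phi> \<psi>)
  then have "sat M S e \<phi> = sat M S e' \<phi>" "sat M S e \<psi> = sat M S e' \<psi>" by (metis UnI1 UnI2 fv.simps(5))+
  then show ?case by simp
next
  case (Ex x \<phi>)
  have "sat M S (e(x := a)) \<phi> = sat M S (e'(x := a)) \<phi>" for a
    by (rule Ex.IH) (use Ex.prems in auto)
  then show ?case by simp
next
  case (Neg \<phi>)
  then have "sat M S e \<phi> = sat M S e' \<phi>" by (metis fv.simps(7))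
  then show ?case by simp
next
  case (Lfp X x \<phi> y)
  have "sat M S' (e(x := a)) \<phi> = sat M S' (e'(x := a)) \<phi>" for a S'
    by (rule Lfp.IH) (use Lfp.prems in auto)
  then show ?case using Lfp.prems by simp
qed auto

section \<open>Monotonicity in positive second-order variables\<close>

text \<open>Both polarities go through one induction because a negation exchanges them. A fixpoint
  that binds \<open>X\<close> itself hides the update, so there both sides coincide.\<close>

lemma sat_mono:
  assumes "A \<subseteq> B"
  shows "(polarity X True \<phi> \<longrightarrow> sat M (S(X := A)) e \<phi> \<longrightarrow> sat M (S(X := B)) e \<phi>) \<and>
         (polarity X False \<phi> \<longrightarrow> sat M (S(X := B)) e \<phi> \<longrightarrow> sat M (S(X := A)) e \<phi>)"
proof (induction \<phi> arbitrary: S e)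
  case (SVar Y x)
  then show ?case using assms by auto
next
  case (Lfp Y x \<phi> y)
  show ?case
  proof (cases "Y = X")
    case False
    \<comment> \<open>Commuting the two updates exposes the one of \<open>X\<close> as the
      outermost, the form in which the induction hypothesis applies.\<close>
    then have swap: "S(X := C, Y := D) = S(Y := D, X := C)" for C D by (rule fun_upd_twist[symmetric])
    let ?F = "\<lambda>C D. {a \<in> univ M. sat M (S(X := C, Y := D)) (e(x := a)) \<phi>}"
    have "lfp (?F A) \<subseteq> lfp (?F B)" if "polarity X True \<phi>"
      by (rule lfp_mono) (unfold swap, use Lfp.IH that in blast)
    moreover have "lfp (?F B) \<subseteq> lfp (?F A)" if "polarity X False \<phi>"
      by (rule lfp_mono) (unfold swap, use Lfp.IH that in blast)
    ultimately show ?thesis using False unfolding sat.simps polarity.simps swap by blast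
  next
    case True
    then show ?thesis unfolding sat.simps by (simp only: fun_upd_upd simp_thms)
  qed
qed auto

lemma mono_sat:
  fixes M :: "('r, 'a) relstruct"
  assumes "polarity X True \<phi>"
  shows "mono (\<lambda>A. {a \<in> univ M. sat M (S(X := A)) (e(x := a)) \<phi>})"
proof (rule monoI)
  fix A B :: "'a set" assume "A \<subseteq> B"
  from sat_mono[OF this, of X \<phi> M S] assms
  have "sat M (S(X := B)) (e(x := a)) \<phi>" if "sat M (S(X := A)) (e(x := a)) \<phi>" for a
    using that by blast
  then show "{a \<in> univ M. sat M (S(X := A)) (e(x := a)) \<phi>} \<subseteq>
      {a \<in> univ M. sat M (S(X := B)) (e(x := a)) \<phi>}" by blast
qed

section \<open>Renaming of bound variables and the rewrite rules\<close>

lemma fv_subst: "y \<notin> vars \<phi> \<Longrightarrow> fv (subst x y \<phi>) = (if x \<in> fv \<phi> then insert y (fv \<phi> - {x}) else fv \<phi>)"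
  by (induction \<phi>) auto

lemma polarity_subst [simp]: "polarity X b (subst x y \<phi>) = polarity X b \<phi>"
  by (induction \<phi> arbitrary: b) auto

text \<open>A renaming trades at most one free variable for a fresh one, so the number of free
  variables below a negation does not grow.\<close>

lemma unfp_subst: "y \<notin> vars \<phi> \<Longrightarrow> unfp ar \<phi> \<Longrightarrow> unfp ar (subst x y \<phi>)"
proof (induction \<phi>)
  case (Neg \<phi>)
  have "card (fv (subst x y \<phi>)) \<le> card (fv \<phi>)"
  proof (cases "x \<in> fv \<phi>")
    case True
    have "card (insert y (fv \<phi> - {x})) \<le> Suc (card (fv \<phi> - {x}))"
      by (simp add: card_insert_if)
    also have "\<dots> = card (fv \<phi>)" using True by (simp only: card_Suc_Diff1 finite_fv)
    finally show ?thesis using Neg.prems True by (simp add: fv_subst)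
  next
    case False
    then show ?thesis using Neg.prems by (simp add: fv_subst)
  qed
  then show ?case using Neg by auto
next
  case (Lfp X z \<phi> u)
  then show ?case by (auto simp: fv_subst)
qed auto

lemma sat_subst: "y \<notin> vars \<phi> \<Longrightarrow> sat M S e (subst x y \<phi>) = sat M S (e(x := e y)) \<phi>"
proof (induction \<phi> arbitrary: S e)
  case (Rel R xs)
  have "map e (map (id(x := y)) xs) = map (e(x := e y)) xs" by auto
  then show ?case by (metis sat.simps(1) subst.simps(1))
next
  case (Ex z \<phi>)
  have "sat M S (e(z := a)) (subst x y \<phi>) = sat M S (e(x := e y, z := a)) \<phi>" if "z \<noteq> x" for a
  proof -
    have "(e(z := a))(x := (e(z := a)) y) = e(x := e y, z := a)" using that Ex.prems by auto
    moreover have "y \<notin> vars \<phi>" using Ex.prems by simp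
    ultimately show ?thesis using Ex.IH by metis
  qed
  then show ?case unfolding sat.simps subst.simps
    by (cases "z = x") (simp_all only: if_True if_False id_apply if_distrib[of e] fun_upd_upd fun_upd_apply simp_thms)
next
  case (Lfp X z \<phi> u)
  have "sat M S' (e(z := a)) (subst x y \<phi>) = sat M S' (e(x := e y, z := a)) \<phi>"
    if "z \<noteq> x" for a S'
  proof -
    have "(e(z := a))(x := (e(z := a)) y) = e(x := e y, z := a)" using that Lfp.prems by auto
    moreover have "y \<notin> vars \<phi>" using Lfp.prems by simp
    ultimately show ?thesis using Lfp.IH by metis
  qed
  then show ?case unfolding sat.simps subst.simps
    by (cases "z = x") (simp_all only: if_True if_False id_apply if_distrib[of e] fun_upd_upd fun_upd_apply simp_thms)
qed auto

lemma sat_rename: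
  assumes "y \<notin> vars \<phi>"
  shows "sat M S (e(y := a)) (subst x y \<phi>) = sat M S (e(x := a)) \<phi>"
  unfolding sat_subst[OF assms] fun_upd_same
  by (rule sat_cong) (use assms fv_subset_vars[of \<phi>] in auto)

lemma un_step_fv: "un_step \<phi> \<psi> \<Longrightarrow> fv \<psi> = fv \<phi>"
proof (induction rule: un_step.induct)
  case (rename_ex y \<phi> x)
  then show ?case using fv_subset_vars[of \<phi>] by (auto simp: fv_subst)
next
  case (rename_lfp y \<phi> X x z)
  then show ?case using fv_subset_vars[of \<phi>] by (auto simp: fv_subst)
qed (simp_all only: fv.simps, blast+)

lemma un_step_polarity: "un_step \<phi> \<psi> \<Longrightarrow> polarity X b \<psi> = polarity X b \<phi>"
  by (induction arbitrary: b rule: un_step.induct) simp_all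

lemma un_step_unfp: "un_step \<phi> \<psi> \<Longrightarrow> unfp ar \<phi> \<Longrightarrow> unfp ar \<psi>"
proof (induction rule: un_step.induct)
  case (rename_lfp y \<phi> X x z)
  then show ?case by (auto simp: unfp_subst fv_subst)
next
  case (neg \<phi> \<phi>')
  then show ?case using un_step_fv[OF neg.hyps] by simp
next
  case (lfp \<phi> \<phi>' X x y)
  then show ?case using un_step_fv[OF lfp.hyps] un_step_polarity[OF lfp.hyps] by simp
qed (simp_all add: unfp_subst)

text \<open>The nonempty universe supplies the witness when a quantifier leaves a disjunction that
  holds through its other disjunct.\<close>

lemma un_step_sat:
  assumes "univ M \<noteq> {}"
  shows "un_step \<phi> \<psi> \<Longrightarrow> sat M S e \<psi> = sat M S e \<phi>"
proof (induction arbitrary: S e rule: un_step.induct)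
  case (pull_and_right x \<phi> \<psi>)
  then have "sat M S (e(x := a)) \<phi> = sat M S e \<phi>" for a by (intro sat_cong) auto
  then show ?case by auto
next
  case (pull_and_left x \<phi> \<psi>)
  then have "sat M S (e(x := a)) \<phi> = sat M S e \<phi>" for a by (intro sat_cong) auto
  then show ?case by auto
next
  case (pull_or_right x \<phi> \<psi>)
  then have "sat M S (e(x := a)) \<phi> = sat M S e \<phi>" for a by (intro sat_cong) auto
  then show ?case using assms by auto
next
  case (pull_or_left x \<phi> \<psi>)
  then have "sat M S (e(x := a)) \<phi> = sat M S e \<phi>" for a by (intro sat_cong) auto
  then show ?case using assms by auto
next
  case (rename_ex y \<phi> x)
  then show ?case by (simp add: sat_rename)
next
  case (rename_lfp y \<phi> X x z)
  then show ?case by (simp add: sat_rename)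
qed simp_all

lemma un_steps_unfp: "un_step\<^sup>*\<^sup>* \<phi> \<psi> \<Longrightarrow> unfp ar \<phi> \<Longrightarrow> unfp ar \<psi>"
  by (induction rule: rtranclp_induct) (auto intro: un_step_unfp)

lemma un_steps_sat: "un_step\<^sup>*\<^sup>* \<phi> \<psi> \<Longrightarrow> univ M \<noteq> {} \<Longrightarrow> sat M S e \<psi> = sat M S e \<phi>"
  by (induction rule: rtranclp_induct) (auto simp: un_step_sat)

section \<open>The tree of all lists over a set\<close>

definition list_edges :: "'c set \<Rightarrow> ('c list \<times> 'c list) set" where
  "list_edges C = {(u, v). u \<in> lists C \<and> v \<in> lists C \<and> (\<exists>c. v = u @ [c] \<or> u = v @ [c])}"

text \<open>The lists extending \<open>w\<close> form a subtree, and its only link to the rest of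
  the tree is the edge between \<open>w\<close> and its parent.\<close>

lemma list_edge_crossing:
  assumes "(s, t) \<in> list_edges C" "prefix w s \<noteq> prefix w t"
  shows "w \<noteq> [] \<and> {s, t} = {butlast w, w}"
  using assms by (auto simp: list_edges_def)

text \<open>A path missing an end of the only edge into the subtree below \<open>w\<close> can
  neither enter nor leave this subtree.\<close>

lemma list_path_stays:
  assumes "successively (\<lambda>s t. (s, t) \<in> list_edges C) p" "w \<notin> set p \<or> butlast w \<notin> set p"
    and "x \<in> set p" "y \<in> set p"
  shows "prefix w x = prefix w y"
proof -
  have "\<forall>x \<in> set p. prefix w x = prefix w (hd p)"
    using assms(1,2)
  proof (induction p rule: induct_list012)
    case (3 a b p)
    then have "\<forall>x \<in> set (b # p). prefix w x = prefix w b" by auto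
    moreover have "prefix w a = prefix w b"
      using list_edge_crossing[of a b C w] 3 by (auto simp: doubleton_eq_iff)
    ultimately show ?case by auto
  qed auto
  then show ?thesis using assms(3,4) by blast
qed

text \<open>Shows that the first step of a simple path depends on its two ends alone: downwards if
  the target lies below the start, upwards otherwise. The reason is that the rest of the path never
  returns to \<open>u\<close>.\<close>

lemma list_path_next:
  assumes "successively (\<lambda>s t. (s, t) \<in> list_edges C) (u # s # p)" "distinct (u # s # p)"
  shows "s = (if strict_prefix u (last (s # p)) then take (Suc (length u)) (last (s # p)) else butlast u)"
proof -
  let ?v = "last (s # p)"
  have v: "?v \<in> set (s # p)" by (rule last_in_set) simp
  have path: "successively (\<lambda>s t. (s, t) \<in> list_edges C) (s # p)" using assms by simp
  from assms(1) consider c where "s = u @ [c]" | c where "u = s @ [c]" by (auto simp: list_edges_def)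
  then show ?thesis
  proof cases
    case 1
    \<comment> \<open>After a step down to \<open>s\<close>, the path avoids the parent
      \<open>u\<close> of \<open>s\<close> and is confined to the subtree of
      \<open>s\<close>.\<close>
    then have "prefix s s = prefix s ?v"
      using assms(2) v by (intro list_path_stays[OF path]) auto
    then show ?thesis using 1 by (auto simp: prefix_def strict_prefix_def)
  next
    case 2
    \<comment> \<open>After a step up, the path avoids \<open>u\<close> and cannot re-enter its
      subtree.\<close>
    then have "prefix u s = prefix u ?v"
      using assms(2) v by (intro list_path_stays[OF path]) auto
    then show ?thesis using 2 by (auto simp: strict_prefix_def)
  qed
qed

lemma list_path_unique:
  assumes "simple_path V (list_edges C) u p v" "simple_path V (list_edges C) u q v"
  shows "p = q"
  using assms
proof (induction p arbitrary: u q)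
  case Nil
  then show ?case by (simp add: simple_path_def)
next
  case (Cons x p)
  then obtain q' where q: "q = u # q'" and x: "x = u"
    by (cases q) (auto simp: simple_path_def)
  show ?case
  proof (cases "p = [] \<or> q' = []")
    case True
    \<comment> \<open>If one path is a single vertex, both ends are equal, and distinctness makes
      the other path a single vertex too.\<close>
    then show ?thesis using Cons.prems q x unfolding simple_path_def
      by (cases p; cases q') (auto split: if_splits)
  next
    case False
    then obtain s p1 t q1 where p1: "p = s # p1" and q1: "q' = t # q1" by (auto simp: neq_Nil_conv)
    have last: "last (s # p1) = v" "last (t # q1) = v"
      using Cons.prems q x p1 q1 unfolding simple_path_def by auto
    have "s = t"
      using list_path_next[of C u s p1] list_path_next[of C u t q1] Cons.prems q x p1 q1
      unfolding simple_path_def last by simp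
    moreover have "simple_path V (list_edges C) s p v" "simple_path V (list_edges C) t q' v"
      using Cons.prems q x p1 q1 unfolding simple_path_def by auto
    ultimately show ?thesis using Cons.IH q x by blast
  qed
qed

text \<open>A walk becomes simple by cutting loops: if the new start already lies on the path, the
  part before it is dropped.\<close>

lemma rtrancl_simple_path:
  assumes "(u, v) \<in> E\<^sup>*" "E \<subseteq> V \<times> V" "v \<in> V"
  shows "\<exists>p. simple_path V E u p v"
  using assms(1)
proof (induction rule: converse_rtrancl_induct)
  case base
  have "simple_path V E v [v] v" using assms(3) by (simp add: simple_path_def)
  then show ?case by blast
next
  case (step u w)
  then obtain p where p: "simple_path V E w p v" by blast
  show ?case
  proof (cases "u \<in> set p")
    case True
    then obtain p1 p2 where "p = p1 @ u # p2" by (meson split_list)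
    then have "simple_path V E u (u # p2) v" using p
      by (auto simp: simple_path_def successively_append_iff)
    then show ?thesis by blast
  next
    case False
    then have "simple_path V E u (u # p) v" using p step(1) assms(2)
      by (auto simp: simple_path_def successively_Cons)
    then show ?thesis by blast
  qed
qed

lemma sym_list_edges: "sym (list_edges C)"
  by (auto simp: sym_def list_edges_def)

lemma is_tree_lists: "is_tree (lists C) (list_edges C)"
proof -
  have to_root: "(u, []) \<in> (list_edges C)\<^sup>*" if "u \<in> lists C" for u
    using that
  proof (induction u rule: rev_induct)
    case (snoc c u)
    then have "(u @ [c], u) \<in> list_edges C" by (auto simp: list_edges_def)
    then show ?case using snoc by (auto intro: converse_rtrancl_into_rtrancl)
  qed simp
  have sub: "list_edges C \<subseteq> lists C \<times> lists C" by (auto simp: list_edges_def)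
  have "\<exists>!p. simple_path (lists C) (list_edges C) u p v" if "u \<in> lists C" "v \<in> lists C" for u v
  proof -
    have "([], v) \<in> (list_edges C)\<^sup>*"
      using sym_rtrancl[OF sym_list_edges] to_root[OF that(2)] by (rule symD)
    with to_root[OF that(1)] have "(u, v) \<in> (list_edges C)\<^sup>*" by (rule rtrancl_trans)
    from rtrancl_simple_path[OF this sub that(2)] show ?thesis
      by (rule ex_ex1I) (rule list_path_unique)
  qed
  moreover have "irrefl (list_edges C)" by (auto simp: irrefl_def list_edges_def)
  moreover have "lists C \<noteq> {}" using lists.Nil by blast
  ultimately show ?thesis
    unfolding is_tree_def using sub sym_list_edges by (intro conjI ballI)
qed

section \<open>The pebble unraveling\<close>

definition bag :: "('a \<times> nat) list \<Rightarrow> ('a \<times> nat) list set" where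
  "bag v = {s. s \<noteq> [] \<and> (\<exists>w. v = s @ w \<and> snd (last s) \<notin> snd ` set w)}"

abbreviation proj :: "('a \<times> nat) list \<Rightarrow> 'a" where
  "proj s \<equiv> fst (last s)"

definition unravel :: "nat \<Rightarrow> ('r, 'a) relstruct \<Rightarrow> ('r, ('a \<times> nat) list) relstruct" where
  "unravel m M = \<lparr>univ = lists (univ M \<times> {..<m}) - {[]},
     interp = (\<lambda>R. {t. map proj t \<in> interp M R \<and> (\<exists>v \<in> lists (univ M \<times> {..<m}). set t \<subseteq> bag v)})\<rparr>"

lemma bag_snocI: "s \<in> bag v \<Longrightarrow> snd (last s) \<noteq> i \<Longrightarrow> s \<in> bag (v @ [(a, i)])"
  by (auto simp: bag_def)

lemma bag_snoc_self: "v @ [p] \<in> bag (v @ [p])"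
  by (auto simp: bag_def)

lemma bag_self: "v \<noteq> [] \<Longrightarrow> v \<in> bag v"
  by (auto simp: bag_def)

text \<open>Members of a bag are prefixes of one list, hence comparable. If two of them ended with
  the same pebble, the longer one would have moved the pebble of the shorter one. Thus a bag has at
  most one member per pebble.\<close>

lemma inj_on_bag: "inj_on (\<lambda>s. snd (last s)) (bag v)"
proof (rule inj_onI)
  have *: "s = s'" if "s \<in> bag v" "s' \<in> bag v" "snd (last s) = snd (last s')" "prefix s s'" for s s'
  proof (rule ccontr)
    assume "s \<noteq> s'"
    with that(4) obtain w where w: "s' = s @ w" "w \<noteq> []" by (auto simp: prefix_def)
    with that(1,2) have "snd (last s) \<notin> snd ` set w" by (auto simp: bag_def)
    moreover have "last s' \<in> set w" using w by simp
    ultimately show False using that(3) by auto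
  qed
  fix s s' assume a: "s \<in> bag v" "s' \<in> bag v" "snd (last s) = snd (last s')"
  then have "prefix s v" "prefix s' v" by (auto simp: bag_def prefix_def)
  then have "prefix s s' \<or> prefix s' s" by (rule prefix_same_cases)
  then show "s = s'" using *[of s s'] *[of s' s] a by auto
qed

lemma last_node: "s \<in> lists P \<Longrightarrow> s \<noteq> [] \<Longrightarrow> last s \<in> P"
  using last_in_set[of s] by (auto simp: in_lists_conv_set)

lemma bag_subset_lists: "v \<in> lists P \<Longrightarrow> bag v \<subseteq> lists P - {[]}"
  by (auto simp: bag_def)

lemma bag_pebbles:
  assumes "v \<in> lists (A \<times> {..<m})"
  shows "(\<lambda>s. snd (last s)) ` bag v \<subseteq> {..<m}"
proof
  fix i assume "i \<in> (\<lambda>s. snd (last s)) ` bag v"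
  then obtain s where s: "s \<in> bag v" "i = snd (last s)" by blast
  then have "s \<in> lists (A \<times> {..<m})" "s \<noteq> []" using bag_subset_lists[OF assms] by auto
  then have "last s \<in> A \<times> {..<m}" by (rule last_node)
  then show "i \<in> {..<m}" unfolding s(2) by (rule mem_Times_iff[THEN iffD1, THEN conjunct2])
qed

lemma finite_bag: "v \<in> lists (A \<times> {..<m}) \<Longrightarrow> finite (bag v)"
  by (rule inj_on_finite[OF inj_on_bag bag_pebbles]) auto

lemma card_bag: "v \<in> lists (A \<times> {..<m}) \<Longrightarrow> card (bag v) \<le> m"
  using card_inj_on_le[OF inj_on_bag bag_pebbles finite_lessThan] by simp

lemma bag_subset_univ: "v \<in> lists (univ M \<times> {..<m}) \<Longrightarrow> bag v \<subseteq> univ (unravel m M)"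
  by (simp only: unravel_def relstruct.simps bag_subset_lists)

lemma proj_in_univ:
  assumes "s \<in> univ (unravel m M)"
  shows "proj s \<in> univ M"
proof -
  have "s \<in> lists (univ M \<times> {..<m})" "s \<noteq> []" using assms by (auto simp: unravel_def)
  then have "last s \<in> univ M \<times> {..<m}" by (rule last_node)
  then show ?thesis by (rule mem_Times_iff[THEN iffD1, THEN conjunct1])
qed

lemma is_structure_unravel:
  assumes "is_structure ar M" "m > 0"
  shows "is_structure ar (unravel m M)"
proof -
  obtain a where "a \<in> univ M" using assms by (auto simp: is_structure_def)
  then have "[(a, 0)] \<in> univ (unravel m M)" using assms by (simp add: unravel_def)
  moreover have "length t = ar R \<and> set t \<subseteq> univ (unravel m M)" if "t \<in> interp (unravel m M) R" for R t
  proof -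
    from that obtain v where "v \<in> lists (univ M \<times> {..<m})" "set t \<subseteq> bag v" "map proj t \<in> interp M R"
      by (auto simp: unravel_def)
    then show ?thesis using assms(1) bag_subset_univ by (fastforce simp: is_structure_def)
  qed
  ultimately show ?thesis unfolding is_structure_def by blast
qed

section \<open>The tree decomposition of the unraveling\<close>

text \<open>Tree nodes have to be lists of elements of the unraveling, so a sequence of moves is
  encoded as the list of its moves, each taken as a sequence of length one; \<open>concat\<close> decodes.\<close>

abbreviation singletons :: "'c set \<Rightarrow> 'c list set" where
  "singletons P \<equiv> (\<lambda>p. [p]) ` P"

lemma concat_singletons:
  "v \<in> lists (singletons P) \<Longrightarrow> concat v \<in> lists P \<and> map (\<lambda>p. [p]) (concat v) = v"
  by (induction v) auto

lemma map_singletons: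
  "s \<in> lists P \<Longrightarrow> map (\<lambda>p. [p]) s \<in> lists (singletons P) \<and> concat (map (\<lambda>p. [p]) s) = s"
  by (induction s) auto

text \<open>Once its pebble is moved, \<open>s\<close> never returns to a bag. Hence every node
  whose bag contains \<open>s\<close> is linked to the node \<open>s\<close> by undoing moves one at
  a time, with \<open>s\<close> in all bags on the way.\<close>

lemma nodes_containing_connected:
  fixes P :: "('a \<times> nat) set" and s :: "('a \<times> nat) list"
  defines "W \<equiv> {v \<in> lists (singletons P). s \<in> bag (concat v)}"
  assumes "u \<in> W" "v \<in> W"
  shows "(u, v) \<in> (list_edges (singletons P) \<inter> W \<times> W)\<^sup>*"
proof -
  let ?E = "list_edges (singletons P) \<inter> W \<times> W"
  have to_s: "(v, map (\<lambda>p. [p]) s) \<in> ?E\<^sup>*" if "v \<in> W" for v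
    using that
  proof (induction v rule: rev_induct)
    case Nil
    then show ?case by (auto simp: W_def bag_def)
  next
    case (snoc c v)
    note IH = snoc.IH and vc = snoc.prems
    then obtain p where c: "c = [p]" and v: "v \<in> lists (singletons P)" by (auto simp: W_def)
    from vc obtain w where w: "concat (v @ [c]) = s @ w" "s \<noteq> []" "snd (last s) \<notin> snd ` set w"
      unfolding W_def bag_def by blast
    show ?case
    \<comment> \<open>Either no move follows \<open>s\<close> and the node is \<open>s\<close>
      itself, or undoing the last move leads to a parent whose bag still contains
      \<open>s\<close>.\<close>
    proof (cases w rule: rev_cases)
      case Nil
      then have "map (\<lambda>p. [p]) s = v @ [c]"
        using w(1) vc concat_singletons[of "v @ [c]" P] by (simp add: W_def)
      then show ?thesis by simp
    next
      case (snoc w' q)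
      then have "s \<in> bag (concat v)" using w c by (auto simp: bag_def)
      then have "v \<in> W" using v by (simp add: W_def)
      moreover have "(v @ [c], v) \<in> list_edges (singletons P)"
        using vc v by (auto simp: list_edges_def W_def)
      ultimately have "(v @ [c], v) \<in> ?E" using vc by blast
      then show ?thesis using IH[OF \<open>v \<in> W\<close>] by (rule converse_rtrancl_into_rtrancl)
    qed
  qed
  have "sym (?E\<^sup>*)" using sym_list_edges by (intro sym_rtrancl) (auto simp: sym_def)
  then show ?thesis using to_s assms(2,3) by (meson rtrancl_trans symD)
qed

lemma tree_width_unravel:
  assumes "m > 0"
  shows "tree_width_at_most (unravel m M :: ('r, ('a \<times> nat) list) relstruct) (m - 1)"
proof -
  define P where "P = univ M \<times> {..<m}"
  let ?V = "lists (singletons P)" and ?B = "\<lambda>v. bag (concat v)"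
  have decode: "concat v \<in> lists (univ M \<times> {..<m})" if "v \<in> ?V" for v
    using concat_singletons[OF that] unfolding P_def ..
  have cover: "(\<Union>v \<in> ?V. ?B v) = univ (unravel m M)"
  proof
    show "(\<Union>v \<in> ?V. ?B v) \<subseteq> univ (unravel m M)"
      by (rule UN_least, rule bag_subset_univ, rule decode)
    show "univ (unravel m M) \<subseteq> (\<Union>v \<in> ?V. ?B v)"
    proof
      fix s assume "s \<in> univ (unravel m M)"
      then have "s \<in> lists P" "s \<noteq> []" by (auto simp: unravel_def P_def)
      then show "s \<in> (\<Union>v \<in> ?V. ?B v)"
        using map_singletons[of s P] bag_self[of s] by (intro UN_I[of "map (\<lambda>p. [p]) s"]) auto
    qed
  qed
  have tuples: "\<exists>v \<in> ?V. set t \<subseteq> ?B v" if "t \<in> interp (unravel m M) R" for R t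
  proof -
    from that obtain v where "v \<in> lists P" "set t \<subseteq> bag v" unfolding unravel_def P_def by auto
    then show ?thesis using map_singletons[of v P] by (intro bexI[of _ "map (\<lambda>p. [p]) v"]) auto
  qed
  have decomp: "tree_decomposition (unravel m M) ?V (list_edges (singletons P)) ?B"
    unfolding tree_decomposition_def Let_def
    by (intro conjI is_tree_lists cover allI ballI tuples, assumption)
      (erule (1) nodes_containing_connected)
  have size: "finite (?B v) \<and> card (?B v) \<le> m - 1 + 1" if "v \<in> ?V" for v
    using finite_bag[OF decode[OF that]] card_bag[OF decode[OF that]] assms by simp
  show ?thesis unfolding tree_width_at_most_def
    by (rule exI, rule exI, rule exI, rule conjI, rule decomp, rule ballI, rule size)
qed

section \<open>Transfer of formulas\<close>

text \<open>\<open>V\<close> is meant to contain all variables of the normal form. With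
  \<open>card V \<le> m\<close> there is a separate pebble for each value that these variables
  take.\<close>

locale unraveling =
  fixes M :: "('r, 'a) relstruct" and m :: nat and V :: "nat set"
  assumes m_pos: "m > 0" and fin_V: "finite V" and card_V: "card V \<le> m" and univ_ne: "univ M \<noteq> {}"
begin

abbreviation N :: "('r, ('a \<times> nat) list) relstruct" where
  "N \<equiv> unravel m M"

abbreviation nodes :: "('a \<times> nat) list set" where
  "nodes \<equiv> lists (univ M \<times> {..<m})"

text \<open>Formulas over \<open>M\<close> and \<open>N\<close> are compared only under second-order
  valuations of \<open>N\<close> that consist of such unions of fibres of the projection.\<close>

definition pull :: "'a set \<Rightarrow> ('a \<times> nat) list set" where
  "pull A = {s \<in> univ N. proj s \<in> A}"

text \<open>The common bag makes relation atoms carry over to \<open>N\<close>; the last condition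
  does the same for equalities, since distinct copies of one element are different.\<close>

definition lift :: "(nat \<Rightarrow> 'a) \<Rightarrow> (nat \<Rightarrow> ('a \<times> nat) list) \<Rightarrow> bool" where
  "lift e e' \<longleftrightarrow> range e' \<subseteq> univ N \<and> (\<exists>v \<in> nodes. \<forall>x \<in> V. e' x \<in> bag v \<and> proj (e' x) = e x) \<and>
     (\<forall>x \<in> V. \<forall>y \<in> V. e x = e y \<longrightarrow> e' x = e' y)"

definition projects :: "'r fm \<Rightarrow> bool" where
  "projects \<phi> \<longleftrightarrow> (\<forall>S e. range e \<subseteq> univ N \<longrightarrow> sat N (pull \<circ> S) e \<phi> \<longrightarrow> sat M S (proj \<circ> e) \<phi>)"

text \<open>This may fail for a relation atom, as arbitrary copies of the entries of a tuple need
  not share a bag. \<open>lifts\<close> is therefore restricted to assignments coming from one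
  bag.\<close>

definition unprojects :: "'r fm \<Rightarrow> bool" where
  "unprojects \<phi> \<longleftrightarrow> (\<forall>S e. range e \<subseteq> univ N \<longrightarrow> sat M S (proj \<circ> e) \<phi> \<longrightarrow> sat N (pull \<circ> S) e \<phi>)"

definition lifts :: "'r fm \<Rightarrow> bool" where
  "lifts \<phi> \<longleftrightarrow> (\<forall>S e e'. lift e e' \<longrightarrow> sat M S e \<phi> \<longrightarrow> sat N (pull \<circ> S) e' \<phi>)"

text \<open>For a block of quantifiers only the free variables are prescribed; the assignment to be lifted
  already contains the witnesses.\<close>

definition lifts_some :: "'r fm \<Rightarrow> bool" where
  "lifts_some \<phi> \<longleftrightarrow> (\<forall>S e. range e \<subseteq> univ M \<longrightarrow> sat M S e \<phi> \<longrightarrow>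
     (\<exists>e1. range e1 \<subseteq> univ M \<and> (\<forall>x \<in> fv \<phi>. e1 x = e x) \<and>
        (\<forall>e'. lift e1 e' \<longrightarrow> sat N (pull \<circ> S) e' \<phi>)))"

section \<open>Copying the values of the variables into one bag\<close>

lemma extend_node:
  assumes "u \<in> nodes" "finite X" "X \<subseteq> univ M" "inj_on f X" "f ` X \<subseteq> {..<m}"
  shows "\<exists>w g. u @ w \<in> nodes \<and> snd ` set w \<subseteq> f ` X \<and>
     (\<forall>x \<in> X. g x \<in> bag (u @ w) \<and> proj (g x) = x \<and> snd (last (g x)) = f x)"
  using assms(2-5)
proof (induction X rule: finite_induct)
  case empty
  then show ?case using assms(1) by (intro exI[of _ "[]"]) simp
next
  case (insert x X)
  have "X \<subseteq> univ M" "inj_on f X" "f ` X \<subseteq> {..<m}" using insert.prems by auto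
  from insert.IH[OF this] obtain w g where w: "u @ w \<in> nodes" "snd ` set w \<subseteq> f ` X"
    and g: "\<forall>x \<in> X. g x \<in> bag (u @ w) \<and> proj (g x) = x \<and> snd (last (g x)) = f x"
    by (elim exE conjE)
  let ?w = "w @ [(x, f x)]" and ?g = "g(x := u @ w @ [(x, f x)])"
  have nodes: "u @ ?w \<in> nodes" and moved: "snd ` set ?w \<subseteq> f ` insert x X"
    using w insert.prems by auto
  have copies: "?g y \<in> bag (u @ ?w) \<and> proj (?g y) = y \<and> snd (last (?g y)) = f y"
    if y: "y \<in> insert x X" for y
  proof (cases "y = x")
    case True
    then show ?thesis using bag_snoc_self[of "u @ w"] by simp
  next
    case False
    \<comment> \<open>By injectivity the new move leaves the pebble of \<open>y\<close> in place, so
      the old copy of \<open>y\<close> remains in the bag.\<close>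
    then have "f y \<noteq> f x" using y inj_onD[OF insert.prems(2), of y x] by blast
    then show ?thesis using False y g bag_snocI[of "g y" "u @ w" "f x" x] by auto
  qed
  show ?case
    by (rule exI[of _ ?w], rule exI[of _ ?g], intro conjI ballI nodes moved) (use copies in blast)+
qed

lemma lift_of_copy:
  assumes "v \<in> nodes" "\<forall>a \<in> e ` V. g a \<in> bag v \<and> proj (g a) = a"
  shows "\<exists>e'. lift e e' \<and> (\<forall>x \<in> V. e' x = g (e x))"
proof -
  obtain a where "a \<in> univ M" using univ_ne by blast
  then have a: "[(a, 0)] \<in> univ N" using m_pos by (simp add: unravel_def)
  \<comment> \<open>Copies are chosen per value and not per variable, so equal values get equal
    copies. The default merely has to be an element of \<open>N\<close>.\<close>
  let ?e' = "\<lambda>x. if x \<in> V then g (e x) else [(a, 0)]"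
  have "range ?e' \<subseteq> univ N" using assms(2) a bag_subset_univ[OF assms(1)] by auto
  moreover have "\<exists>v \<in> nodes. \<forall>x \<in> V. ?e' x \<in> bag v \<and> proj (?e' x) = e x"
    by (rule bexI[OF _ assms(1)]) (use assms(2) in simp)
  ultimately have "lift e ?e'" unfolding lift_def by simp
  then show ?thesis by (intro exI[of _ ?e']) simp
qed

lemma lift_exists:
  assumes "range e \<subseteq> univ M"
  shows "\<exists>e'. lift e e'"
proof -
  have "card (e ` V) \<le> card {..<m}" using card_image_le[OF fin_V, of e] card_V by simp
  then obtain f where f: "f ` (e ` V) \<subseteq> {..<m}" "inj_on f (e ` V)"
    using card_le_inj[of "e ` V" "{..<m}"] fin_V by blast
  have V: "finite (e ` V)" "e ` V \<subseteq> univ M" using assms fin_V by auto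
  from extend_node[OF lists.Nil V f(2,1)] obtain w g where w: "[] @ w \<in> nodes"
    and g: "\<forall>x \<in> e ` V. g x \<in> bag ([] @ w) \<and> proj (g x) = x \<and> snd (last (g x)) = f x"
    by (elim exE conjE)
  from lift_of_copy[OF w, of e g] g show ?thesis by blast
qed

text \<open>The play continues from \<open>b\<close> without moving its last pebble. The value of
  \<open>z\<close> is already represented by \<open>b\<close>, so the other \<open>m - 1\<close>
  pebbles suffice for the remaining values.\<close>

lemma lift_exists_at:
  assumes "range e \<subseteq> univ M" "b \<in> univ N" "z \<in> V" "e z = proj b"
  shows "\<exists>e'. lift e e' \<and> e' z = b"
proof -
  let ?i = "snd (last b)" and ?X = "e ` V - {proj b}"
  have b: "b \<in> nodes" "b \<noteq> []" using assms(2) by (auto simp: unravel_def)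
  have i: "?i < m" using last_node[OF b] by (simp add: mem_Times_iff)
  \<comment> \<open>Membership makes the removal of \<open>proj b\<close> save one value, matching
    the one pebble that is reserved.\<close>
  have "proj b \<in> e ` V" using assms by (metis imageI)
  then have "card ?X \<le> card ({..<m} - {?i})"
    using i card_image_le[OF fin_V, of e] card_V fin_V by (simp add: card_Diff_singleton)
  then obtain f where f: "f ` ?X \<subseteq> {..<m} - {?i}" "inj_on f ?X"
    using card_le_inj[of ?X "{..<m} - {?i}"] fin_V by blast
  have X: "finite ?X" "?X \<subseteq> univ M" "f ` ?X \<subseteq> {..<m}" using assms(1) f(1) fin_V by auto
  from extend_node[OF b(1) X(1,2) f(2) X(3)] obtain w g where w: "b @ w \<in> nodes" "snd ` set w \<subseteq> f ` ?X"
    and g: "\<forall>x \<in> ?X. g x \<in> bag (b @ w) \<and> proj (g x) = x \<and> snd (last (g x)) = f x"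
    by (elim exE conjE)
  have "?i \<notin> snd ` set w" using w(2) f(1) by blast
  then have "b \<in> bag (b @ w)" using b(2) by (simp add: bag_def)
  then have "\<forall>a \<in> e ` V. (g(proj b := b)) a \<in> bag (b @ w) \<and> proj ((g(proj b := b)) a) = a"
    using g by auto
  from lift_of_copy[OF w(1) this] assms(3,4) show ?thesis by fastforce
qed

section \<open>Unary formulas\<close>

lemma lifts_imp_lifts_some: "lifts \<phi> \<Longrightarrow> lifts_some \<phi>"
  unfolding lifts_def lifts_some_def by blast

text \<open>A lift can be made to take a prescribed copy at one variable. With at most one free
  variable this determines the truth value, so truth carries over to every copy.\<close>

lemma unary_unprojects:
  assumes "lifts_some \<phi>" "card (fv \<phi>) \<le> 1" "vars \<phi> \<subseteq> V"
  shows "unprojects \<phi>"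
  unfolding unprojects_def
proof (intro allI impI)
  fix S e assume e: "range e \<subseteq> univ N" and s: "sat M S (proj \<circ> e) \<phi>"
  have "range (proj \<circ> e) \<subseteq> univ M" using e proj_in_univ by fastforce
  then obtain e1 where e1: "range e1 \<subseteq> univ M" "\<forall>x \<in> fv \<phi>. e1 x = proj (e x)"
    "\<forall>e'. lift e1 e' \<longrightarrow> sat N (pull \<circ> S) e' \<phi>"
    using assms(1) s unfolding lifts_some_def comp_def by blast
  have "\<exists>e'. lift e1 e' \<and> (\<forall>x \<in> fv \<phi>. e' x = e x)"
  proof (cases "fv \<phi> = {}")
    case True
    then show ?thesis using lift_exists[OF e1(1)] by blast
  next
    case False
    then have "card (fv \<phi>) = 1" using assms(2) by (simp add: le_Suc_eq)
    then obtain z where z: "fv \<phi> = {z}" by (rule card_1_singletonE)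
    have "z \<in> V" using z assms(3) fv_subset_vars[of \<phi>] by blast
    moreover have "e z \<in> univ N" using e by blast
    moreover have "e1 z = proj (e z)" using e1(2) z by simp
    ultimately obtain e' where "lift e1 e'" "e' z = e z" using lift_exists_at[OF e1(1)] by metis
    then show ?thesis using z by (intro exI[of _ e']) simp
  qed
  then obtain e' where e': "lift e1 e'" "\<forall>x \<in> fv \<phi>. e' x = e x" by blast
  have "sat N (pull \<circ> S) e' \<phi> = sat N (pull \<circ> S) e \<phi>"
    by (rule sat_cong) (use e'(2) in blast)
  then show "sat N (pull \<circ> S) e \<phi>" using e1(3) e'(1) by simp
qed

lemma unprojects_lifts:
  assumes "unprojects \<phi>" "vars \<phi> \<subseteq> V"
  shows "lifts \<phi>"
  unfolding lifts_def
proof (intro allI impI)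
  fix S e e' assume l: "lift e e'" and s: "sat M S e \<phi>"
  have "proj (e' x) = e x" if "x \<in> V" for x using l that unfolding lift_def by blast
  then have "sat M S (proj \<circ> e') \<phi> = sat M S e \<phi>"
    using assms(2) fv_subset_vars[of \<phi>] by (intro sat_cong) auto
  moreover have "range e' \<subseteq> univ N" using l unfolding lift_def ..
  ultimately show "sat N (pull \<circ> S) e' \<phi>" using assms(1) s unfolding unprojects_def by simp
qed

section \<open>Fixpoints under the projection\<close>

lemma pull_upd: "(pull \<circ> S)(X := pull A) = pull \<circ> S(X := A)"
  by (simp only: fun_upd_comp)

lemma proj_upd: "(proj \<circ> e)(x := proj b) = proj \<circ> e(x := b)"
  by (simp only: fun_upd_comp)

lemma range_upd: "range e \<subseteq> A \<Longrightarrow> a \<in> A \<Longrightarrow> range (e(x := a)) \<subseteq> A"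
  by auto

lemma sat_proj_iff:
  assumes "projects \<phi>" "unprojects \<phi>" "range e \<subseteq> univ N"
  shows "sat N (pull \<circ> S) e \<phi> = sat M S (proj \<circ> e) \<phi>"
  using assms(1)[unfolded projects_def, rule_format, OF assms(3)]
    assms(2)[unfolded unprojects_def, rule_format, OF assms(3)] by (rule iffI)

text \<open>On unions of fibres the operator of \<open>N\<close> is the pullback of the operator of
  \<open>M\<close>. So the pulled back least fixpoint is a fixpoint in \<open>N\<close>, which gives
  one inclusion.\<close>

lemma lfp_pull:
  assumes "projects \<phi>" "unprojects \<phi>" "polarity X True \<phi>" "range e \<subseteq> univ N"
  shows "lfp (\<lambda>A. {b \<in> univ N. sat N ((pull \<circ> S)(X := A)) (e(x := b)) \<phi>}) =
         pull (lfp (\<lambda>A. {a \<in> univ M. sat M (S(X := A)) ((proj \<circ> e)(x := a)) \<phi>}))"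
    (is "lfp ?FN = pull (lfp ?FM)")
proof -
  have FN: "?FN (pull A) = pull (?FM A)" for A
  proof -
    have "sat N ((pull \<circ> S)(X := pull A)) (e(x := b)) \<phi> =
        sat M (S(X := A)) ((proj \<circ> e)(x := proj b)) \<phi>" if "b \<in> univ N" for b
      unfolding pull_upd proj_upd
      by (rule sat_proj_iff[OF assms(1,2) range_upd[OF assms(4) that]])
    then show ?thesis using proj_in_univ unfolding pull_def by blast
  qed
  have mono_FM: "mono ?FM" using assms(3) by (rule mono_sat)
  have mono_FN: "mono ?FN" using assms(3) by (rule mono_sat)
  show ?thesis
  proof
    show "lfp ?FN \<subseteq> pull (lfp ?FM)"
      by (rule lfp_lowerbound) (simp only: FN lfp_unfold[OF mono_FM, symmetric] order_refl)
    \<comment> \<open>\<open>?A\<close> is the largest set whose pullback lies in the least fixpoint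
      of \<open>N\<close>. Being closed under the operator of \<open>M\<close>, it contains the
      least fixpoint of \<open>M\<close>.\<close>
    let ?A = "{a. \<forall>b \<in> univ N. proj b = a \<longrightarrow> b \<in> lfp ?FN}"
    have "pull ?A \<subseteq> lfp ?FN" unfolding pull_def by blast
    from monoD[OF mono_FN this] have "pull (?FM ?A) \<subseteq> lfp ?FN"
      unfolding FN lfp_unfold[OF mono_FN, symmetric] .
    then have "?FM ?A \<subseteq> ?A" unfolding pull_def by blast
    then have "lfp ?FM \<subseteq> ?A" by (rule lfp_lowerbound)
    then show "pull (lfp ?FM) \<subseteq> lfp ?FN" unfolding pull_def by blast
  qed
qed

section \<open>Transfer along the syntax\<close>

lemma projects_Rel: "projects (Rel R xs)"
  unfolding projects_def sat.simps unravel_def by simp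

lemma lifts_Rel:
  assumes "set xs \<subseteq> V"
  shows "lifts (Rel R xs)"
  unfolding lifts_def
proof (intro allI impI)
  fix S e e' assume "lift e e'" and s: "sat M S e (Rel R xs)"
  then obtain v where v: "v \<in> nodes" "\<forall>x \<in> V. e' x \<in> bag v \<and> proj (e' x) = e x"
    unfolding lift_def by (elim conjE bexE)
  then have "map proj (map e' xs) = map e xs" using assms by auto
  with s have "map proj (map e' xs) \<in> interp M R" by (simp only: sat.simps)
  moreover have "set (map e' xs) \<subseteq> bag v" using v assms by auto
  ultimately show "sat N (pull \<circ> S) e' (Rel R xs)" using v(1) by (auto simp: unravel_def)
qed

lemma projects_Ex:
  assumes "projects \<phi>"
  shows "projects (Ex x \<phi>)"
  unfolding projects_def
proof (intro allI impI)
  fix S e assume e: "range e \<subseteq> univ N" and "sat N (pull \<circ> S) e (Ex x \<phi>)"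
  then obtain b where b: "b \<in> univ N" "sat N (pull \<circ> S) (e(x := b)) \<phi>" unfolding sat.simps by blast
  from assms[unfolded projects_def, rule_format, OF range_upd[OF e b(1)] b(2)]
  have "sat M S ((proj \<circ> e)(x := proj b)) \<phi>" unfolding proj_upd .
  then show "sat M S (proj \<circ> e) (Ex x \<phi>)" using proj_in_univ[OF b(1)] unfolding sat.simps by blast
qed

text \<open>The assignment obtained for the body serves unchanged: any lift \<open>e'\<close> of it
  satisfies the body, so \<open>e' x\<close> is a witness in \<open>N\<close>.\<close>

lemma lifts_some_Ex:
  assumes "lifts_some \<phi>"
  shows "lifts_some (Ex x \<phi>)"
  unfolding lifts_some_def
proof (intro allI impI)
  fix S e assume e: "range e \<subseteq> univ M" and "sat M S e (Ex x \<phi>)"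
  then obtain a where a: "a \<in> univ M" "sat M S (e(x := a)) \<phi>" unfolding sat.simps by blast
  from assms[unfolded lifts_some_def, rule_format, OF range_upd[OF e a(1)] a(2)]
  obtain e1 where e1: "range e1 \<subseteq> univ M" "\<forall>y \<in> fv \<phi>. e1 y = (e(x := a)) y"
    and lifted: "\<forall>e'. lift e1 e' \<longrightarrow> sat N (pull \<circ> S) e' \<phi>" by (elim exE conjE)
  have "sat N (pull \<circ> S) e' (Ex x \<phi>)" if l: "lift e1 e'" for e'
  proof -
    have "e' x \<in> univ N" using l unfolding lift_def by blast
    moreover have "sat N (pull \<circ> S) (e'(x := e' x)) \<phi>" using lifted l by simp
    ultimately show ?thesis unfolding sat.simps by (rule bexI[rotated])
  qed
  moreover have "\<forall>y \<in> fv (Ex x \<phi>). e1 y = e y" using e1(2) by simp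
  ultimately show "\<exists>e1. range e1 \<subseteq> univ M \<and> (\<forall>y \<in> fv (Ex x \<phi>). e1 y = e y) \<and>
      (\<forall>e'. lift e1 e' \<longrightarrow> sat N (pull \<circ> S) e' (Ex x \<phi>))"
    using e1(1) by (intro exI[of _ e1]) simp
qed

text \<open>Conjunctions need \<open>lifts\<close>, since both conjuncts must hold under one
  assignment, whereas \<open>lifts_some\<close> would let each choose its own. The flag
  \<open>False\<close> at their immediate subformulas provides it: a quantifier there starts a unary
  formula.\<close>

lemma transfer:
  assumes "unfp ar \<phi>" "un_nf_at b \<phi>" "vars \<phi> \<subseteq> V"
  shows "projects \<phi> \<and> lifts_some \<phi> \<and> (un_nf_at False \<phi> \<longrightarrow> lifts \<phi>)"
  using assms
proof (induction \<phi> arbitrary: b)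
  case (Rel R xs)
  then have "lifts (Rel R xs)" by (intro lifts_Rel) simp
  then show ?case by (simp only: projects_Rel lifts_imp_lifts_some simp_thms)
next
  case (Eq x y)
  have "projects (Eq x y)" unfolding projects_def by simp
  moreover have "lifts (Eq x y)" using Eq.prems unfolding lifts_def lift_def by simp
  ultimately show ?case by (simp only: lifts_imp_lifts_some simp_thms)
next
  case (SVar X x)
  have "projects (SVar X x)" "unprojects (SVar X x)"
    unfolding projects_def unprojects_def by (auto simp: pull_def)
  then show ?case using unprojects_lifts[OF _ SVar.prems(3)]
    by (simp only: lifts_imp_lifts_some simp_thms)
next
  case (And \<phi> \<psi>)
  have "projects \<phi>" "projects \<psi>" "lifts \<phi>" "lifts \<psi>"
    using And.IH(1)[of False] And.IH(2)[of False] And.prems by simp_all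
  then have "projects (And \<phi> \<psi>)" "lifts (And \<phi> \<psi>)" unfolding projects_def lifts_def by simp_all
  then show ?case by (simp only: lifts_imp_lifts_some simp_thms)
next
  case (Or \<phi> \<psi>)
  have "projects \<phi>" "projects \<psi>" "lifts \<phi>" "lifts \<psi>"
    using Or.IH(1)[of False] Or.IH(2)[of False] Or.prems by simp_all
  then have "projects (Or \<phi> \<psi>)" "lifts (Or \<phi> \<psi>)" unfolding projects_def lifts_def sat.simps by metis+
  then show ?case by (simp only: lifts_imp_lifts_some simp_thms)
next
  case (Ex x \<phi>)
  have "projects \<phi>" "lifts_some \<phi>" using Ex.IH[of True] Ex.prems by simp_all
  then have proj: "projects (Ex x \<phi>)" and some: "lifts_some (Ex x \<phi>)"
    by (auto intro: projects_Ex lifts_some_Ex)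
  have "lifts (Ex x \<phi>)" if "un_nf_at False (Ex x \<phi>)"
  proof (rule unprojects_lifts[OF unary_unprojects[OF some]])
    show "card (fv (Ex x \<phi>)) \<le> 1" using that by simp
  qed (rule Ex.prems(3))+
  then show ?case using proj some by simp
next
  case (Neg \<phi>)
  have IH: "projects \<phi>" "lifts_some \<phi>" and unary: "card (fv \<phi>) \<le> 1" and V: "vars \<phi> \<subseteq> V"
    using Neg.IH[of False] Neg.prems by simp_all
  \<comment> \<open>Negation exchanges \<open>projects\<close> and \<open>unprojects\<close>, so
    both are required of the body.\<close>
  have "unprojects \<phi>" using unary_unprojects[OF IH(2) unary V] .
  then have "projects (Neg \<phi>)" "unprojects (Neg \<phi>)"
    using sat_proj_iff[OF IH(1)] unfolding projects_def unprojects_def by simp_all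
  then show ?case using unprojects_lifts[OF _ Neg.prems(3)]
    by (simp only: lifts_imp_lifts_some simp_thms)
next
  case (Lfp X x \<phi> y)
  have IH: "projects \<phi>" "lifts_some \<phi>" and V: "vars \<phi> \<subseteq> V" and pol: "polarity X True \<phi>"
    using Lfp.IH[of False] Lfp.prems by simp_all
  have unary: "card (fv \<phi>) \<le> 1" using Lfp.prems(1) card_mono[of "{x}" "fv \<phi>"] by simp
  have un: "unprojects \<phi>" using unary_unprojects[OF IH(2) unary V] .
  have "sat N (pull \<circ> S) e (Lfp X x \<phi> y) = sat M S (proj \<circ> e) (Lfp X x \<phi> y)"
    if "range e \<subseteq> univ N" for S e
  proof -
    have "e y \<in> univ N" using that by blast
    then show ?thesis unfolding sat.simps lfp_pull[OF IH(1) un pol that] by (simp add: pull_def)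
  qed
  then have "projects (Lfp X x \<phi> y)" "unprojects (Lfp X x \<phi> y)"
    unfolding projects_def unprojects_def by blast+
  then show ?case using unprojects_lifts[OF _ Lfp.prems(3)]
    by (simp only: lifts_imp_lifts_some simp_thms)
qed

end

section \<open>The model of bounded tree-width\<close>

theorem theorem3p6:
  fixes ar :: "'r \<Rightarrow> nat" and \<phi> :: "'r fm" and k :: nat
  assumes "unfp ar \<phi>"
    and "has_width k \<phi>"
    and "satisfiable TYPE('a) ar \<phi>"
  shows "\<exists>(N :: ('r, ('a \<times> nat) list) relstruct) S e.
           is_model ar N S e \<phi> \<and> tree_width_at_most N (k - 1)"
proof -
  obtain \<psi> where steps: "un_step\<^sup>*\<^sup>* \<phi> \<psi>" and nf: "un_nf_at True \<psi>" and k: "card (vars \<psi>) \<le> k"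
    using assms(2) unfolding has_width_def un_normal_form_def by blast
  obtain M :: "('r, 'a) relstruct" and S e where M: "is_structure ar M" and e: "range e \<subseteq> univ M"
    and "sat M S e \<phi>"
    using assms(3) unfolding satisfiable_def is_model_def by blast
  have ne: "univ M \<noteq> {}" using M by (simp add: is_structure_def)
  \<comment> \<open>One pebble is kept even for \<open>k = 0\<close>, so that the unraveling is
    nonempty; \<open>m - 1 = k - 1\<close> still holds by truncated subtraction.\<close>
  define m where "m = max 1 k"
  have m: "m > 0" "m - 1 = k - 1" "k \<le> m" by (auto simp: m_def)
  interpret unraveling M m "vars \<psi>"
    using m k ne by unfold_locales auto
  have N: "is_structure ar N" using is_structure_unravel[OF M m(1)] .
  have "sat M S e \<psi>" using \<open>sat M S e \<phi>\<close> un_steps_sat[OF steps ne] by blast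
  \<comment> \<open>The root may start a quantifier block with several free variables, so
    \<open>lifts_some\<close> is the form available here; it suffices for satisfiability.\<close>
  moreover have "lifts_some \<psi>" using transfer[OF un_steps_unfp[OF steps assms(1)] nf] by blast
  ultimately obtain e1 where "range e1 \<subseteq> univ M" "\<forall>e'. lift e1 e' \<longrightarrow> sat N (pull \<circ> S) e' \<psi>"
    using e unfolding lifts_some_def by metis
  then obtain e' where e': "lift e1 e'" "sat N (pull \<circ> S) e' \<psi>" using lift_exists[of e1] by metis
  have "sat N (pull \<circ> S) e' \<phi>"
    using e'(2) un_steps_sat[OF steps, of N] N unfolding is_structure_def by simp
  moreover have "\<forall>x. e' x \<in> univ N" using e'(1) unfolding lift_def by blast
  moreover have "\<forall>X. (pull \<circ> S) X \<subseteq> univ N" by (auto simp: pull_def)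
  ultimately have "is_model ar N (pull \<circ> S) e' \<phi>" using N unfolding is_model_def by simp
  with tree_width_unravel[OF m(1), of M, unfolded m(2)] show ?thesis by (intro exI conjI)
qed

end
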